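(* Let $S:=\langle s_{01},s_{23}\rangle\le\Lambda$. The stabilizer of $S$ in $\mathrm{GL}_4(\mathbb K)$ is $$\mathrm{GL}_4(\mathbb K)_S=\left\{\begin{pmatrix} A & 0 \\ 0 & B \end{pmatrix}\ \middle|\ A,B\in\mathrm{GL}_2(\mathbb K)\right\}\cup\left\{\begin{pmatrix} 0 & A \\ B & 0 \end{pmatrix}\ \middle|\ A,B\in\mathrm{GL}_2(\mathbb K)\right\}=\mathrm{GL}_4(\mathbb K)_{S^\perp}.$$ Its orbits on $\mathbb K^4$ are represented by $0$, $b_0$, $b_0+b_2$; those on $\Lambda/S$ are represented by $S$, $s_{02}+S$, $s_{02}+s_{13}+S$; and those on $\Lambda/S^\perp$ by $S^\perp$, $s_{01}+S^\perp$, $s_{01}+s_{23}+S^\perp$.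
   Context: $\mathbb K$ is an arbitrary field; $X'$ denotes the transpose of a matrix $X$; $b_0,b_1,b_2,b_3$ is the standard basis of $\mathbb K^4$ (column vectors). $\Lambda=\mathbb K^4\wedge\mathbb K^4$ is the space of skew-symmetric $4\times4$ matrices over $\mathbb K$ with zero diagonal, and $s_{jk}:=b_jb_k'-b_kb_j'$ for $0\le j<k\le3$. The group $\mathrm{GL}_4(\mathbb K)$ acts on $\mathbb K^4$ naturally and on $\Lambda$ by $M.X:=MXM'$. For $U\le\Lambda$, $\mathrm{GL}_4(\mathbb K)_U$ is the stabilizer of $U$ under this action; it acts on $\Lambda/U$. $\langle\cdots\rangle$ denotes $\mathbb K$-span. The orthogonal space $U^\perp$ is taken with respect to the polar form of the Pfaffian quadratic form $\mathrm{pf}\bigl(\sum_{j<k}x_{jk}s_{jk}\bigr)=x_{01}x_{23}-x_{02}x_{13}+x_{03}x_{12}$; thus $S^\perp=\langle s_{02},s_{03},s_{12},s_{13}\rangle$. "The orbits are represented by" a list means that each orbit contains exactly one member of the list. *)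

theory Defs
  imports
    "HOL-Analysis.Analysis"
    "HOL-Algebra.Group_Action"
    "HOL-Library.Set_Algebras"
begin

text \<open>
  Rows, columns and basis vectors are indexed by the type \<^typ>\<open>4\<close>, whose elements are
  0, 1, 2, 3; this is the index range of the basis \<open>b 0, b 1, b 2, b 3\<close>.
\<close>

definition b :: "4 \<Rightarrow> 'a::field^4" where
  "b j = axis j 1"

definition s :: "4 \<Rightarrow> 4 \<Rightarrow> 'a::field^4^4" where
  "s j k = columnvector (b j) ** (rowvector (b k) :: 'a^4^1)
         - columnvector (b k) ** (rowvector (b j) :: 'a^4^1)"

text \<open>
  The library operation \<open>*s\<close> would scale a matrix by a row vector, so scaling by an element
  of the field is introduced here; the interpretation provides \<open>mat.span\<close>.
\<close>

definition mat_scale :: "'a::field \<Rightarrow> 'a^4^4 \<Rightarrow> 'a^4^4" where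
  "mat_scale c X = (\<chi> i j. c * X $ i $ j)"

interpretation mat: vector_space mat_scale
  by unfold_locales (auto simp: mat_scale_def vec_eq_iff algebra_simps)

text \<open>The condition on the diagonal is not redundant in characteristic 2.\<close>

definition Lam :: "('a::field^4^4) set" where
  "Lam = {X. transpose X = - X \<and> (\<forall>i. X $ i $ i = 0)}"

text \<open>For \<open>j < k\<close> the coefficient of \<open>s j k\<close> in \<open>X \<in> Lam\<close> is the entry \<open>X $ j $ k\<close>.\<close>

definition pf :: "'a::field^4^4 \<Rightarrow> 'a" where
  "pf X = X $ 0 $ 1 * X $ 2 $ 3 - X $ 0 $ 2 * X $ 1 $ 3 + X $ 0 $ 3 * X $ 1 $ 2"

definition pf_polar :: "'a::field^4^4 \<Rightarrow> 'a^4^4 \<Rightarrow> 'a" where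
  "pf_polar X Y = pf (X + Y) - pf X - pf Y"

definition perp :: "('a::field^4^4) set \<Rightarrow> ('a^4^4) set" where
  "perp U = {X \<in> Lam. \<forall>Y\<in>U. pf_polar X Y = 0}"

definition GL4 :: "('a::field^4^4) monoid" where
  "GL4 = \<lparr>carrier = {M. invertible M}, mult = (**), one = mat 1\<rparr>"

lemma group_GL4: "group (GL4 :: ('a::field^4^4) monoid)"
proof (rule groupI)
  fix M :: "'a^4^4"
  assume "M \<in> carrier GL4"
  then obtain N where "M ** N = mat 1" "N ** M = mat 1"
    by (auto simp: GL4_def invertible_def)
  then show "\<exists>N\<in>carrier GL4. N \<otimes>\<^bsub>GL4\<^esub> M = \<one>\<^bsub>GL4\<^esub>"
    by (auto simp: GL4_def invertible_def)
qed (auto simp: GL4_def invertible_mult matrix_mul_assoc invertible_def[of "mat 1"])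

definition act :: "'a::field^4^4 \<Rightarrow> 'a^4^4 \<Rightarrow> 'a^4^4" where
  "act M X = M ** X ** transpose M"

text \<open>
  The action on subsets of \<^const>\<open>Lam\<close>, in particular on subspaces \<open>U\<close> and, for elements of the
  stabilizer of \<open>U\<close>, on the cosets of \<open>U\<close>.
\<close>

abbreviation act_set :: "'a::field^4^4 \<Rightarrow> ('a^4^4) set \<Rightarrow> ('a^4^4) set" where
  "act_set M \<equiv> image (act M)"

abbreviation GL4_stab :: "('a::field^4^4) set \<Rightarrow> ('a^4^4) monoid" where
  "GL4_stab U \<equiv> GL4\<lparr>carrier := stabilizer GL4 act_set U\<rparr>"

definition Lam_quot :: "('a::field^4^4) set \<Rightarrow> ('a^4^4) set set" where
  "Lam_quot U = {X +o U | X. X \<in> Lam}"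

text \<open>
  The block matrix with rows \<open>(A B)\<close> and \<open>(C D)\<close>; \<open>half\<close> sends an index to its position inside
  its block.
\<close>

definition half :: "4 \<Rightarrow> 2" where
  "half i = (if i = 0 \<or> i = 2 then 0 else 1)"

definition block4 :: "'a::field^2^2 \<Rightarrow> 'a^2^2 \<Rightarrow> 'a^2^2 \<Rightarrow> 'a^2^2 \<Rightarrow> 'a^4^4" where
  "block4 A B C D = (\<chi> i j.
     (if i \<in> {0, 1}
      then (if j \<in> {0, 1} then A else B)
      else (if j \<in> {0, 1} then C else D)) $ half i $ half j)"

text \<open>
  Counting list positions rather than elements, so that the listed representatives are
  also required to be pairwise distinct.
\<close>

definition orbits_represented_by ::
    "('g, 'm) monoid_scheme \<Rightarrow> 'x set \<Rightarrow> ('g \<Rightarrow> 'x \<Rightarrow> 'x) \<Rightarrow> 'x list \<Rightarrow> bool" where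
  "orbits_represented_by G E \<phi> xs \<longleftrightarrow>
     set xs \<subseteq> E \<and> (\<forall>Orb \<in> orbits G E \<phi>. \<exists>!i. i < length xs \<and> xs ! i \<in> Orb)"

end

theory Submission
  imports Defs
begin

text \<open>
  Every \<open>X \<in> Lam\<close> is a block matrix \<open>skew4 x C y\<close> with diagonal blocks \<open>x J\<close>, \<open>y J\<close> and upper right
  block \<open>C\<close>, where \<open>J = skew2 1\<close>; \<open>S\<close> consists of those with \<open>C = 0\<close> and its orthogonal space of
  those with \<open>x = y = 0\<close>. A matrix with block rows \<open>(A B)\<close>, \<open>(C D)\<close> that stabilizes \<open>S\<close> satisfies
  \<open>A J C' = 0 = B J D'\<close>, which forces it to be block diagonal or block antidiagonal. One that
  stabilizes the orthogonal space satisfies the same equations for its transpose. The group acts on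
  \<open>Lam/S\<close> by \<open>C \<mapsto> A C B'\<close> and \<open>C \<mapsto> - A C' B'\<close>, so the rank of \<open>C\<close> separates the orbits; on the
  other two sets the orbits are separated by the number of nonzero components in the two blocks.
\<close>

section \<open>Index types and matrix algebra\<close>

text \<open>The library rules enumerate these cyclic index types as 1, 2 and 1, ..., 4. Identifying
  the last index with 0 allows them to be restated for the ranges 0, 1 and 0, ..., 3.\<close>

lemma two_eq_0: "(2 :: 2) = 0"
  by simp

lemma four_eq_0: "(4 :: 4) = 0"
  by simp

lemma all_2: "(\<forall>i::2. P i) \<longleftrightarrow> P 0 \<and> P 1"
  unfolding forall_2 two_eq_0 by auto

lemma sum_2': "sum f (UNIV :: 2 set) = f 0 + f 1"
  unfolding sum_2 two_eq_0 by (simp add: add.commute)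

lemma det_2': "det (A :: 'a::comm_ring_1^2^2) = A $ 0 $ 0 * A $ 1 $ 1 - A $ 0 $ 1 * A $ 1 $ 0"
  unfolding det_2 two_eq_0 by (simp add: mult.commute)

lemma all_4: "(\<forall>i::4. P i) \<longleftrightarrow> P 0 \<and> P 1 \<and> P 2 \<and> P 3"
  unfolding forall_4 four_eq_0 by auto

lemma sum_4': "sum f (UNIV :: 4 set) = f 0 + f 1 + f 2 + f 3"
  unfolding sum_4 four_eq_0 by (simp add: ac_simps)

lemma invertible_transpose_iff:
  "invertible (transpose A) \<longleftrightarrow> invertible (A :: 'a::field^'n^'n)"
  by (simp add: invertible_det_nz)

lemma matrix_mult_minus_left: "(- A) ** B = - (A ** (B :: 'a::ring_1^'p^'n))"
  by (simp add: matrix_matrix_mult_def vec_eq_iff sum_negf)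

lemma matrix_mult_minus_right: "A ** (- B) = - (A ** (B :: 'a::ring_1^'p^'n))"
  by (simp add: matrix_matrix_mult_def vec_eq_iff sum_negf)

lemma transpose_minus: "transpose (- A) = - transpose (A :: 'a::ring_1^'p^'n)"
  by (simp add: transpose_def vec_eq_iff)

lemma transpose_add: "transpose (A + B) = transpose A + transpose (B :: 'a::ring_1^'p^'n)"
  by (simp add: transpose_def vec_eq_iff)

lemma transpose_0 [simp]: "transpose (0 :: 'a::ring_1^'p^'n) = 0"
  by (simp add: transpose_def vec_eq_iff)

lemma matrix_add_rdistrib: "(A + B) ** C = A ** C + B ** (C :: 'a::ring_1^'p^'n)"
  by (simp add: matrix_matrix_mult_def vec_eq_iff distrib_right sum.distrib)

section \<open>Block matrices with 2x2 blocks\<close>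

lemma half_simps [simp]: "half 0 = 0" "half 1 = 1" "half 2 = 0" "half 3 = 1"
  by (simp_all add: half_def)

lemma block4_nth [simp]:
  "block4 A B C D $ 0 $ 0 = A $ 0 $ 0" "block4 A B C D $ 0 $ 1 = A $ 0 $ 1"
  "block4 A B C D $ 1 $ 0 = A $ 1 $ 0" "block4 A B C D $ 1 $ 1 = A $ 1 $ 1"
  "block4 A B C D $ 0 $ 2 = B $ 0 $ 0" "block4 A B C D $ 0 $ 3 = B $ 0 $ 1"
  "block4 A B C D $ 1 $ 2 = B $ 1 $ 0" "block4 A B C D $ 1 $ 3 = B $ 1 $ 1"
  "block4 A B C D $ 2 $ 0 = C $ 0 $ 0" "block4 A B C D $ 2 $ 1 = C $ 0 $ 1"
  "block4 A B C D $ 3 $ 0 = C $ 1 $ 0" "block4 A B C D $ 3 $ 1 = C $ 1 $ 1"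
  "block4 A B C D $ 2 $ 2 = D $ 0 $ 0" "block4 A B C D $ 2 $ 3 = D $ 0 $ 1"
  "block4 A B C D $ 3 $ 2 = D $ 1 $ 0" "block4 A B C D $ 3 $ 3 = D $ 1 $ 1"
  by (simp_all add: block4_def)

lemma block4_cases:
  obtains A B C D where "M = block4 A B C D"
proof
  show "M = block4
      (\<chi> i j. M $ (if i = 0 then 0 else 1) $ (if j = 0 then 0 else 1))
      (\<chi> i j. M $ (if i = 0 then 0 else 1) $ (if j = 0 then 2 else 3))
      (\<chi> i j. M $ (if i = 0 then 2 else 3) $ (if j = 0 then 0 else 1))
      (\<chi> i j. M $ (if i = 0 then 2 else 3) $ (if j = 0 then 2 else 3))"
    by (simp add: vec_eq_iff all_4)
qed

lemma block4_eq_iff: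
  "block4 A B C D = block4 A' B' C' D' \<longleftrightarrow> A = A' \<and> B = B' \<and> C = C' \<and> D = D'"
  by (auto simp: vec_eq_iff all_4 all_2)

lemma block4_add:
  "block4 A B C D + block4 A' B' C' D' = block4 (A + A') (B + B') (C + C') (D + D')"
  by (simp add: vec_eq_iff all_4)

lemma block4_mult:
  "block4 A B C D ** block4 A' B' C' D' =
    block4 (A ** A' + B ** C') (A ** B' + B ** D') (C ** A' + D ** C') (C ** B' + D ** D')"
  by (simp add: vec_eq_iff all_4 matrix_matrix_mult_def sum_4' sum_2' add.assoc)

lemma transpose_block4:
  "transpose (block4 A B C D) = block4 (transpose A) (transpose C) (transpose B) (transpose D)"
  by (simp add: vec_eq_iff all_4 transpose_def)

lemma mat_1_block4: "mat 1 = block4 (mat 1) 0 0 (mat 1)"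
  by (simp add: vec_eq_iff all_4 mat_def)

section \<open>Alternating 2x2 matrices\<close>

definition skew2 :: "'a::field \<Rightarrow> 'a^2^2" where
  "skew2 c = (\<chi> i j. if i = j then 0 else if i = 0 then c else - c)"

lemma skew2_nth [simp]:
  "skew2 c $ 0 $ 0 = 0" "skew2 c $ 0 $ 1 = c" "skew2 c $ 1 $ 0 = - c" "skew2 c $ 1 $ 1 = 0"
  by (simp_all add: skew2_def)

lemma skew2_eq_iff: "skew2 c = skew2 d \<longleftrightarrow> c = d"
  by (auto simp: vec_eq_iff all_2)

lemma skew2_0 [simp]: "skew2 0 = 0"
  by (simp add: vec_eq_iff all_2)

lemma transpose_skew2: "transpose (skew2 c) = - skew2 c"
  by (simp add: vec_eq_iff all_2 transpose_def)

text \<open>Alternating 2x2 matrices form a line, so a congruence acts on them by a scalar, which is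
  the determinant. In particular a singular \<open>A\<close> annihilates them all.\<close>

lemma skew2_congruence: "A ** skew2 c ** transpose A = skew2 (det A * c)"
  by (simp add: vec_eq_iff all_2 transpose_def matrix_matrix_mult_def sum_2' det_2' algebra_simps)

lemma invertible_skew2: "c \<noteq> 0 \<Longrightarrow> invertible (skew2 c)"
  by (simp add: invertible_det_nz det_2')

lemma invertible_mult_eq_0_left:
  "invertible (A :: 'a::field^'n^'n) \<Longrightarrow> A ** B = 0 \<Longrightarrow> B = 0"
  by (metis invertible_left_inverse matrix_mul_assoc matrix_mul_lid times0_right)

lemma skew2_isotropic_sym:
  assumes "A ** skew2 1 ** transpose C = (0 :: 'a::field^2^2)"
  shows "C ** skew2 1 ** transpose A = 0"
proof -
  have "transpose (A ** skew2 1 ** transpose C) = 0"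
    by (simp only: assms) (simp add: vec_eq_iff transpose_def)
  then show ?thesis
    by (simp add: matrix_transpose_mul transpose_skew2
        matrix_mult_minus_left matrix_mult_minus_right matrix_mul_assoc)
qed

text \<open>If \<open>A\<close> is invertible, so is \<open>A ** skew2 1\<close>, and it can be
  cancelled.\<close>

lemma skew2_isotropic_left:
  assumes "A ** skew2 1 ** transpose C = (0 :: 'a::field^2^2)" "invertible A"
  shows "C = 0"
proof -
  have "transpose C = 0"
    using assms invertible_mult_eq_0_left[of "A ** skew2 1"] invertible_mult invertible_skew2
    by (metis zero_neq_one)
  then show ?thesis
    by (simp add: vec_eq_iff transpose_def)
qed

section \<open>Block monomial matrices\<close>

text \<open>This is the wreath product of GL_2 with the group of order 2, the common value of both
  stabilizers.\<close>

definition block_monomial :: "('a::field^4^4) set" where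
  "block_monomial =
    {block4 A 0 0 B | A B. invertible A \<and> invertible B} \<union>
    {block4 0 A B 0 | A B. invertible A \<and> invertible B}"

lemma invertible_block_diag_iff:
  "invertible (block4 A 0 0 B) \<longleftrightarrow> invertible A \<and> invertible B"
proof
  assume "invertible (block4 A 0 0 B)"
  then obtain N where N: "block4 A 0 0 B ** N = mat 1"
    by (auto simp: invertible_right_inverse)
  obtain P Q R T where "N = block4 P Q R T"
    by (rule block4_cases)
  with N show "invertible A \<and> invertible B"
    by (auto simp: mat_1_block4 block4_mult block4_eq_iff invertible_right_inverse)
next
  assume "invertible A \<and> invertible B"
  then obtain A' B' where "A ** A' = mat 1" "B ** B' = mat 1"
    by (auto simp: invertible_right_inverse)
  then have "block4 A 0 0 B ** block4 A' 0 0 B' = mat 1"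
    by (simp add: mat_1_block4 block4_mult)
  then show "invertible (block4 A 0 0 B)"
    by (auto simp: invertible_right_inverse)
qed

lemma invertible_block_antidiag_iff:
  "invertible (block4 0 A B 0) \<longleftrightarrow> invertible A \<and> invertible B"
proof
  assume "invertible (block4 0 A B 0)"
  then obtain N where N: "block4 0 A B 0 ** N = mat 1"
    by (auto simp: invertible_right_inverse)
  obtain P Q R T where "N = block4 P Q R T"
    by (rule block4_cases)
  with N show "invertible A \<and> invertible B"
    by (auto simp: mat_1_block4 block4_mult block4_eq_iff invertible_right_inverse)
next
  assume "invertible A \<and> invertible B"
  then obtain A' B' where "A ** A' = mat 1" "B ** B' = mat 1"
    by (auto simp: invertible_right_inverse)
  then have "block4 0 A B 0 ** block4 0 B' A' 0 = mat 1"
    by (simp add: mat_1_block4 block4_mult)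
  then show "invertible (block4 0 A B 0)"
    by (auto simp: invertible_right_inverse)
qed

lemma invertible_block_monomial: "M \<in> block_monomial \<Longrightarrow> invertible M"
  by (auto simp: block_monomial_def invertible_block_diag_iff invertible_block_antidiag_iff)

lemma block_monomial_iff:
  "block4 A B C D \<in> block_monomial \<longleftrightarrow>
    invertible (block4 A B C D) \<and> (B = 0 \<and> C = 0 \<or> A = 0 \<and> D = 0)"
  by (auto simp: block_monomial_def block4_eq_iff invertible_block_diag_iff
      invertible_block_antidiag_iff)

text \<open>Needed for the stabilizer of the orthogonal space, where the isotropy conditions arise
  for the transposed matrix.\<close>

lemma transpose_block_monomial_iff:
  "transpose M \<in> block_monomial \<longleftrightarrow> M \<in> block_monomial"
proof -
  obtain A B C D where M: "M = block4 A B C D"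
    by (rule block4_cases)
  have tr0: "transpose X = 0 \<longleftrightarrow> X = 0" for X :: "'a^2^2"
    by (auto simp: vec_eq_iff transpose_def)
  show ?thesis
    unfolding M transpose_block4 block_monomial_iff
    by (auto simp: tr0 invertible_transpose_iff simp flip: transpose_block4)
qed

lemma block_monomial_inverse:
  assumes "M \<in> block_monomial"
  obtains N where "N \<in> block_monomial" "M ** N = mat 1"
proof -
  from assms obtain A B where inv: "invertible A" "invertible B"
      and M: "M = block4 A 0 0 B \<or> M = block4 0 A B 0"
    by (auto simp: block_monomial_def)
  from inv obtain A' B' where "A ** A' = mat 1" "B ** B' = mat 1" "invertible A'" "invertible B'"
    by (metis invertible_left_inverse invertible_right_inverse)
  then have "block4 A' 0 0 B' \<in> block_monomial" "block4 A 0 0 B ** block4 A' 0 0 B' = mat 1"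
      "block4 0 B' A' 0 \<in> block_monomial" "block4 0 A B 0 ** block4 0 B' A' 0 = mat 1"
    by (auto simp: mat_1_block4 block4_mult block_monomial_def)
  then show ?thesis
    using that M by metis
qed

text \<open>
  With \<open>J = skew2 1\<close>, any \<open>X = P A + Q C\<close> satisfies
  \<open>X J X' = det A P J P' + det C Q J Q' + (mixed terms in A J C')\<close>. Taking for \<open>P\<close>, \<open>Q\<close> the
  upper blocks of the inverse gives \<open>X = 1\<close>, so \<open>A\<close> and \<open>C\<close> are not both singular.
\<close>

lemma block_monomialI:
  assumes inv: "invertible (block4 A B C D)"
    and AC: "A ** skew2 1 ** transpose C = (0 :: 'a::field^2^2)"
    and BD: "B ** skew2 1 ** transpose D = 0"
  shows "block4 A B C D \<in> block_monomial"
proof -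
  from inv obtain N where N: "block4 A B C D ** N = mat 1" "N ** block4 A B C D = mat 1"
    by (auto simp: invertible_def)
  obtain P Q R T where N_eq: "N = block4 P Q R T"
    by (rule block4_cases)
  from N have eqs: "A ** P + B ** R = mat 1" "C ** Q + D ** T = mat 1" "P ** A + Q ** C = mat 1"
    by (simp_all add: N_eq mat_1_block4 block4_mult block4_eq_iff)
  have CA: "C ** skew2 1 ** transpose A = 0" and DB: "D ** skew2 1 ** transpose B = 0"
    using AC BD by (auto dest: skew2_isotropic_sym)
  have "invertible A \<or> invertible C"
  proof (rule ccontr)
    assume "\<not> (invertible A \<or> invertible C)"
    then have sing: "A ** skew2 1 ** transpose A = 0" "C ** skew2 1 ** transpose C = 0"
      by (simp_all add: invertible_det_nz skew2_congruence)
    have "(P ** A + Q ** C) ** skew2 1 ** transpose (P ** A + Q ** C) =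
        P ** (A ** skew2 1 ** transpose A) ** transpose P
        + P ** (A ** skew2 1 ** transpose C) ** transpose Q
        + Q ** (C ** skew2 1 ** transpose A) ** transpose P
        + Q ** (C ** skew2 1 ** transpose C) ** transpose Q"
      by (simp add: transpose_add matrix_transpose_mul matrix_add_ldistrib matrix_add_rdistrib
          matrix_mul_assoc)
    then have "skew2 1 = (0 :: 'a^2^2)"
      by (simp add: eqs sing AC CA transpose_mat)
    then show False
      by (simp add: vec_eq_iff all_2)
  qed
  then show ?thesis
  proof
    assume "invertible A"
    then have "C = 0"
      using AC by (rule skew2_isotropic_left[rotated])
    \<comment> \<open>With \<open>C = 0\<close>, the second block equation reduces to
      \<open>D ** T = mat 1\<close>.\<close>
    moreover from this eqs have "invertible D"
      by (auto simp: invertible_right_inverse)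
    then have "B = 0"
      using DB by (rule skew2_isotropic_left[rotated])
    ultimately show ?thesis
      using inv by (simp add: block_monomial_iff)
  next
    assume "invertible C"
    then have "A = 0"
      using CA by (rule skew2_isotropic_left[rotated])
    \<comment> \<open>With \<open>A = 0\<close>, the first block equation reduces to
      \<open>B ** R = mat 1\<close>.\<close>
    moreover from this eqs have "invertible B"
      by (auto simp: invertible_right_inverse)
    then have "D = 0"
      using BD by (rule skew2_isotropic_left[rotated])
    ultimately show ?thesis
      using inv by (simp add: block_monomial_iff)
  qed
qed

section \<open>Coordinates on \<open>Lam\<close>, on \<open>S\<close> and on its orthogonal
  space\<close>

text \<open>The scalars are the coefficients of \<open>s 0 1\<close> and \<open>s 2 3\<close>; the
  rows of \<open>C\<close> hold those of \<open>s 0 2\<close>, \<open>s 0 3\<close> and of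
  \<open>s 1 2\<close>, \<open>s 1 3\<close>.\<close>

definition skew4 :: "'a::field \<Rightarrow> 'a^2^2 \<Rightarrow> 'a \<Rightarrow> 'a^4^4" where
  "skew4 x C y = block4 (skew2 x) C (- transpose C) (skew2 y)"

lemma skew4_eq_iff: "skew4 x C y = skew4 x' C' y' \<longleftrightarrow> x = x' \<and> C = C' \<and> y = y'"
  by (auto simp: skew4_def block4_eq_iff skew2_eq_iff)

lemma skew4_add: "skew4 x C y + skew4 x' C' y' = skew4 (x + x') (C + C') (y + y')"
  by (simp add: skew4_def block4_add vec_eq_iff all_4 transpose_def)

lemma skew4_0: "skew4 0 0 0 = 0"
  by (simp add: skew4_def vec_eq_iff all_4 transpose_def)

lemma skew4_scale: "mat_scale c (skew4 x C y) = skew4 (c * x) (\<chi> i j. c * C $ i $ j) (c * y)"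
  by (simp add: skew4_def mat_scale_def vec_eq_iff all_4 transpose_def)

lemma Lam_eq: "Lam = {skew4 x C y | x C y. True}"
proof (intro subset_antisym subsetI)
  fix X :: "'a^4^4"
  assume X: "X \<in> Lam"
  obtain A B C D where X_eq: "X = block4 A B C D"
    by (rule block4_cases)
  from X have diag: "X $ i $ i = 0" for i
    by (simp add: Lam_def)
  have skew: "X $ j $ i = - X $ i $ j" for i j
  proof -
    have "X $ j $ i = transpose X $ i $ j"
      by (simp add: transpose_def)
    also have "\<dots> = - X $ i $ j"
      using X by (simp add: Lam_def)
    finally show ?thesis .
  qed
  from skew[of 1 0] skew[of 2 0] skew[of 3 0] skew[of 2 1] skew[of 3 1] skew[of 3 2]
    diag[of 0] diag[of 1] diag[of 2] diag[of 3]
  have "X = skew4 (A $ 0 $ 1) B (D $ 0 $ 1)"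
    by (simp add: X_eq skew4_def vec_eq_iff all_4 all_2 transpose_def)
  then show "X \<in> {skew4 x C y | x C y. True}"
    by blast
qed (auto simp: Lam_def skew4_def vec_eq_iff all_4 transpose_def)

lemma s_eq_skew4:
  "s 0 1 = skew4 1 0 0" "s 2 3 = skew4 0 0 1" "s 0 2 = skew4 0 (axis 0 (axis 0 1)) 0"
  "s 1 3 = skew4 0 (axis 1 (axis 1 1)) 0"
  by (simp_all add: s_def b_def skew4_def vec_eq_iff all_4 transpose_def matrix_matrix_mult_def
      columnvector_def rowvector_def axis_def mat_def)

text \<open>The left side is the block \<open>C\<close> of \<open>s 0 2 + s 1 3\<close>, the
  representative of rank 2.\<close>

lemma axis_add_axis_eq_mat_1: "axis 0 (axis 0 1) + axis 1 (axis 1 1) = (mat 1 :: 'a::field^2^2)"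
  by (simp add: vec_eq_iff all_2 axis_def mat_def)

lemma span_s01_s23: "mat.span {s 0 1, s 2 3} = {skew4 x 0 y | x y. True}"
proof -
  have "mat.span {s 0 1, s 2 3} = {mat_scale x (s 0 1) + mat_scale y (s 2 3) | x y. True}"
    by (auto simp: mat.span_insert mat.span_singleton algebra_simps)
  also have "\<dots> = {skew4 x 0 y | x y. True}"
    by (simp add: s_eq_skew4 skew4_scale skew4_add) (simp flip: zero_vec_def)
  finally show ?thesis .
qed

text \<open>In these coordinates the quadratic form is an orthogonal sum of a hyperbolic plane,
  which is \<open>S\<close>, and the form \<open>- det C\<close>.\<close>

lemma pf_skew4: "pf (skew4 x C y) = x * y - det C"
  by (simp add: pf_def skew4_def det_2')

lemma perp_s01_s23: "perp (mat.span {s 0 1, s 2 3}) = {skew4 0 C 0 | C. True}"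
proof -
  have polar: "pf_polar (skew4 x C y) (skew4 z 0 w) = x * w + y * z" for x y z w :: 'a and C
    by (simp add: pf_polar_def pf_skew4 skew4_add det_2' algebra_simps)
  \<comment> \<open>Pairing with \<open>s 2 3\<close> reads off \<open>x\<close>, and pairing with
    \<open>s 0 1\<close> reads off \<open>y\<close>.\<close>
  have "x = 0 \<and> y = 0" if "\<And>z w. pf_polar (skew4 x C y) (skew4 z 0 w) = 0" for x y :: 'a and C
    using that[of 0 1] that[of 1 0] by (simp add: polar)
  note nondegenerate = this
  show ?thesis
  proof (intro subset_antisym subsetI)
    fix X :: "'a^4^4"
    assume X: "X \<in> perp (mat.span {s 0 1, s 2 3})"
    then obtain x C y where X_eq: "X = skew4 x C y"
      by (auto simp: perp_def Lam_eq)
    have "pf_polar (skew4 x C y) (skew4 z 0 w) = 0" for z w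
      using X by (auto simp: X_eq perp_def span_s01_s23)
    then have "x = 0 \<and> y = 0"
      by (rule nondegenerate)
    then show "X \<in> {skew4 0 C 0 | C. True}"
      by (auto simp: X_eq)
  qed (auto simp: perp_def Lam_eq span_s01_s23 polar)
qed

section \<open>The action in coordinates and the two stabilizers\<close>

lemma act_block_diag:
  "act (block4 A 0 0 B) (skew4 x C y) = skew4 (det A * x) (A ** C ** transpose B) (det B * y)"
  by (simp add: act_def skew4_def transpose_block4 block4_mult block4_eq_iff skew2_congruence
      matrix_transpose_mul matrix_mult_minus_left matrix_mult_minus_right matrix_mul_assoc)

text \<open>The swap moves the lower left block \<open>- transpose C\<close> to the upper right,
  which accounts for the sign and the transpose.\<close>

lemma act_block_antidiag:
  "act (block4 0 A B 0) (skew4 x C y) =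
    skew4 (det A * y) (- (A ** transpose C ** transpose B)) (det B * x)"
  by (simp add: act_def skew4_def transpose_block4 block4_mult block4_eq_iff skew2_congruence
      matrix_transpose_mul matrix_mult_minus_left matrix_mult_minus_right matrix_mul_assoc
      transpose_minus)

lemma act_mult: "act (M ** N) X = act M (act N X)"
  by (simp add: act_def matrix_transpose_mul matrix_mul_assoc)

lemma act_mat_1: "act (mat 1) X = X"
  by (simp add: act_def)

lemma act_add: "act M (X + Y) = act M X + act M Y"
  by (simp add: act_def matrix_add_ldistrib matrix_add_rdistrib)

text \<open>Membership in a stabilizer demands that \<open>U\<close> be mapped onto itself. Since
  the inverse of a block monomial matrix is again block monomial, mapping \<open>U\<close> into
  itself suffices.\<close>

lemma block_monomial_subset_stabilizer:
  assumes "\<And>M X. M \<in> block_monomial \<Longrightarrow> X \<in> U \<Longrightarrow> act M X \<in> U"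
  shows "block_monomial \<subseteq> stabilizer GL4 act_set U"
proof
  fix M :: "'a^4^4"
  assume M: "M \<in> block_monomial"
  obtain N where N: "N \<in> block_monomial" "M ** N = mat 1"
    using M by (rule block_monomial_inverse)
  have "U \<subseteq> act_set M U"
  proof
    fix X
    assume "X \<in> U"
    then have "X = act M (act N X)" "act N X \<in> U"
      using N assms by (auto simp: act_mat_1 simp flip: act_mult)
    then show "X \<in> act_set M U"
      by blast
  qed
  then show "M \<in> stabilizer GL4 act_set U"
    using M assms invertible_block_monomial by (fastforce simp: stabilizer_def GL4_def)
qed

lemma stabilizer_span:
  "stabilizer GL4 act_set {skew4 x 0 y | x y. True} = block_monomial"
proof (intro subset_antisym subsetI)
  fix M :: "'a^4^4"
  assume "M \<in> stabilizer GL4 act_set {skew4 x 0 y | x y. True}"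
  then have inv: "invertible M" and "act_set M {skew4 x 0 y | x y. True} \<subseteq> {skew4 x 0 y | x y. True}"
    by (simp_all add: stabilizer_def GL4_def)
  then have st: "\<exists>x' y'. act M (skew4 x 0 y) = skew4 x' 0 y'" for x y
    by blast
  obtain A B C D where M: "M = block4 A B C D"
    by (rule block4_cases)
  \<comment> \<open>These are the upper right blocks of the images of \<open>s 0 1\<close> and
    \<open>s 2 3\<close>.\<close>
  have "A ** skew2 1 ** transpose C = 0" "B ** skew2 1 ** transpose D = 0"
    using st[of 1 0] st[of 0 1]
    by (auto simp: M act_def skew4_def transpose_block4 block4_mult block4_eq_iff)
  then show "M \<in> block_monomial"
    using inv by (simp add: M block_monomialI)
next
  fix M :: "'a^4^4"
  assume "M \<in> block_monomial"
  moreover have "block_monomial \<subseteq> stabilizer GL4 act_set {skew4 x (0 :: 'a^2^2) y | x y. True}"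
    by (rule block_monomial_subset_stabilizer)
      (auto simp: block_monomial_def act_block_diag act_block_antidiag skew4_eq_iff)
  ultimately show "M \<in> stabilizer GL4 act_set {skew4 x 0 y | x y. True}"
    by blast
qed

lemma stabilizer_perp:
  "stabilizer GL4 act_set {skew4 0 C 0 | C. True} = block_monomial"
proof (intro subset_antisym subsetI)
  fix M :: "'a^4^4"
  assume "M \<in> stabilizer GL4 act_set {skew4 0 C 0 | C. True}"
  then have inv: "invertible M" and "act_set M {skew4 0 C 0 | C. True} \<subseteq> {skew4 0 C 0 | C. True}"
    by (simp_all add: stabilizer_def GL4_def)
  then have st: "\<exists>C. act M (skew4 0 E 0) = skew4 0 C 0" for E
    by blast
  obtain A B C D where M: "M = block4 A B C D"
    by (rule block4_cases)
  \<comment> \<open>The diagonal blocks of the image of \<open>skew4 0 E 0\<close> have to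
    vanish.\<close>
  have st': "A ** E ** transpose B - B ** transpose E ** transpose A = 0"
      "C ** E ** transpose D - D ** transpose E ** transpose C = 0" for E
    using st[of E]
    by (auto simp: M act_def skew4_def transpose_block4 block4_mult block4_eq_iff
        matrix_mult_minus_left matrix_mult_minus_right)
  \<comment> \<open>For a matrix unit \<open>E\<close>, the entry at 0, 1 of the hypothesis is the
    determinant formed by a column of \<open>X\<close> and a column of \<open>Y\<close>. These four
    determinants are the entries of \<open>transpose X ** skew2 1 ** Y\<close>.\<close>
  have minors: "transpose X ** skew2 1 ** Y = 0"
    if "\<And>E. X ** E ** transpose Y - Y ** transpose E ** transpose X = 0" for X Y :: "'a^2^2"
  proof -
    have "(X ** E ** transpose Y - Y ** transpose E ** transpose X) $ 0 $ 1 = 0" for E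
      by (simp only: that zero_index)
    from this[of "axis 0 (axis 0 1)"] this[of "axis 0 (axis 1 1)"]
      this[of "axis 1 (axis 0 1)"] this[of "axis 1 (axis 1 1)"]
    have "X $ 0 $ 0 * Y $ 1 $ 0 = X $ 1 $ 0 * Y $ 0 $ 0" "X $ 0 $ 0 * Y $ 1 $ 1 = X $ 1 $ 0 * Y $ 0 $ 1"
      "X $ 0 $ 1 * Y $ 1 $ 0 = X $ 1 $ 1 * Y $ 0 $ 0" "X $ 0 $ 1 * Y $ 1 $ 1 = X $ 1 $ 1 * Y $ 0 $ 1"
      by (simp_all add: matrix_matrix_mult_def sum_2' transpose_def axis_def mult.commute)
    then show ?thesis
      by (simp add: vec_eq_iff all_2 matrix_matrix_mult_def sum_2' transpose_def)
  qed
  \<comment> \<open>Transposing exchanges the off-diagonal blocks, so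
    \<open>transpose A ** skew2 1 ** B = 0\<close> and
    \<open>transpose C ** skew2 1 ** D = 0\<close> are the isotropy conditions for
    \<open>transpose M\<close>.\<close>
  have "transpose M \<in> block_monomial"
    using inv minors[OF st'(1)] minors[OF st'(2)]
    unfolding M transpose_block4
    by (intro block_monomialI) (simp_all add: invertible_transpose_iff flip: transpose_block4)
  then show "M \<in> block_monomial"
    by (simp add: transpose_block_monomial_iff)
next
  fix M :: "'a^4^4"
  assume "M \<in> block_monomial"
  moreover have "block_monomial \<subseteq> stabilizer GL4 act_set {skew4 0 (C :: 'a^2^2) 0 | C. True}"
    by (rule block_monomial_subset_stabilizer)
      (auto simp: block_monomial_def act_block_diag act_block_antidiag skew4_eq_iff)
  ultimately show "M \<in> stabilizer GL4 act_set {skew4 0 C 0 | C. True}"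
    by blast
qed

section \<open>Recognizing orbit representatives by an invariant\<close>

text \<open>The invariant \<open>f\<close> returns the list position of the representative:
  \<open>red\<close> provides a listed element in each orbit, and any such element of the orbit of
  \<open>x\<close> must stand at position \<open>f x\<close>.\<close>

lemma orbits_represented_byI:
  fixes f :: "'x \<Rightarrow> nat"
  assumes sub: "set xs \<subseteq> E"
    and inv: "\<And>g x. g \<in> carrier G \<Longrightarrow> x \<in> E \<Longrightarrow> f (\<phi> g x) = f x"
    and sep: "\<And>i. i < length xs \<Longrightarrow> f (xs ! i) = i"
    and red: "\<And>x. x \<in> E \<Longrightarrow> \<exists>g\<in>carrier G. \<phi> g x \<in> set xs"
  shows "orbits_represented_by G E \<phi> xs"
proof -
  have "\<exists>!i. i < length xs \<and> xs ! i \<in> orbit G \<phi> x" if x: "x \<in> E" for x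
  proof -
    obtain g where g: "g \<in> carrier G" "\<phi> g x \<in> set xs"
      using red[OF x] by blast
    then obtain i where i: "i < length xs" "xs ! i = \<phi> g x"
      by (auto simp: in_set_conv_nth)
    have "j = f x" if "j < length xs" "xs ! j \<in> orbit G \<phi> x" for j
      using that inv[OF _ x] sep[of j] by (auto simp: orbit_def)
    moreover have "xs ! i \<in> orbit G \<phi> x"
      using g i by (auto simp: orbit_def)
    ultimately show ?thesis
      using i(1) by blast
  qed
  then show ?thesis
    using sub unfolding orbits_represented_by_def orbits_def by blast
qed

lemma act_set_coset: "act_set M (X +o (U :: ('a::field^4^4) set)) = act M X +o act_set M U"
proof -
  have "X +o U = (+) X ` U" for X and U :: "('a^4^4) set"
    by (auto simp: elt_set_plus_def)
  then show ?thesis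
    by (simp add: image_image act_add)
qed

text \<open>Lets the invariant and the reduction be stated for matrices instead of cosets;
  \<open>coset\<close> makes \<open>f\<close> descend to the quotient.\<close>

lemma orbits_represented_by_cosetsI:
  fixes f :: "'a::field^4^4 \<Rightarrow> nat"
  assumes stab: "\<And>M. M \<in> carrier G \<Longrightarrow> act_set M U = U"
    and Lam: "\<And>M X. M \<in> carrier G \<Longrightarrow> X \<in> Lam \<Longrightarrow> act M X \<in> Lam"
    and zero: "0 \<in> U"
    and coset: "\<And>X Y. X \<in> Lam \<Longrightarrow> Y \<in> U \<Longrightarrow> f (X + Y) = f X"
    and inv: "\<And>M X. M \<in> carrier G \<Longrightarrow> X \<in> Lam \<Longrightarrow> f (act M X) = f X"
    and reps: "set Rs \<subseteq> Lam"
    and sep: "\<And>i. i < length Rs \<Longrightarrow> f (Rs ! i) = i"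
    and red: "\<And>X. X \<in> Lam \<Longrightarrow> \<exists>M\<in>carrier G. \<exists>R\<in>set Rs. act M X +o U = R +o U"
  shows "orbits_represented_by G (Lam_quot U) act_set (map (\<lambda>R. R +o U) Rs)"
proof -
  \<comment> \<open>The value on a coset is taken at an arbitrarily chosen representative; the next
    fact shows that the choice does not matter.\<close>
  define F where "F Y = f (SOME X. X \<in> Lam \<and> Y = X +o U)" for Y
  have F: "F (X +o U) = f X" if X: "X \<in> Lam" for X
  proof -
    define X' where "X' = (SOME X'. X' \<in> Lam \<and> X +o U = X' +o U)"
    have X': "X' \<in> Lam \<and> X +o U = X' +o U"
      unfolding X'_def by (rule someI[of _ X]) (use X in simp)
    \<comment> \<open>As \<open>0\<close> lies in \<open>U\<close>, the chosen \<open>X'\<close>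
      lies in its own coset and hence differs from \<open>X\<close> by an element of
      \<open>U\<close>.\<close>
    have "X' + 0 \<in> X' +o U"
      using zero by (rule set_plus_intro2)
    then have "X' \<in> X +o U"
      using X' by simp
    then obtain Y where "Y \<in> U" "X' = X + Y"
      by (auto simp: elt_set_plus_def)
    then show ?thesis
      using coset[OF X] by (simp add: F_def flip: X'_def)
  qed
  show ?thesis
  proof (rule orbits_represented_byI[where f = F])
    show "set (map (\<lambda>R. R +o U) Rs) \<subseteq> Lam_quot U"
      using reps by (auto simp: Lam_quot_def)
    show "F (act_set M Y) = F Y" if "M \<in> carrier G" "Y \<in> Lam_quot U" for M Y
      using that by (auto simp: Lam_quot_def act_set_coset stab F Lam inv)
    show "F (map (\<lambda>R. R +o U) Rs ! i) = i" if "i < length (map (\<lambda>R. R +o U) Rs)" for i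
      using that reps nth_mem[of i Rs] by (auto simp: F sep subset_iff)
    show "\<exists>M\<in>carrier G. act_set M Y \<in> set (map (\<lambda>R. R +o U) Rs)" if Y: "Y \<in> Lam_quot U" for Y
    proof -
      obtain X where X: "X \<in> Lam" "Y = X +o U"
        using Y by (auto simp: Lam_quot_def)
      obtain M R where M: "M \<in> carrier G" "R \<in> set Rs" "act M X +o U = R +o U"
        using red[OF X(1)] by blast
      then have "act_set M Y = R +o U"
        by (simp add: X act_set_coset stab)
      with M(1,2) show ?thesis
        by auto
    qed
  qed
qed

section \<open>Orbits on vectors\<close>

lemma invertible_mult_eq_0_left_iff:
  "invertible (A :: 'a::field^'n^'n) \<Longrightarrow> A ** B = 0 \<longleftrightarrow> B = 0"
  by (auto dest: invertible_mult_eq_0_left)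

lemma invertible_mult_eq_0_right_iff:
  "invertible (B :: 'a::field^'n^'n) \<Longrightarrow> A ** B = 0 \<longleftrightarrow> A = 0"
  by (metis invertible_right_inverse matrix_mul_assoc matrix_mul_rid times0_left)

lemma invertible_mult_vec_eq_0_iff:
  "invertible (A :: 'a::field^'n^'n) \<Longrightarrow> A *v u = 0 \<longleftrightarrow> u = 0"
  by (metis invertible_left_inverse matrix_vector_mul_assoc matrix_vector_mul_lid
      matrix_vector_mult_0_right)

definition mat2 :: "'a \<Rightarrow> 'a \<Rightarrow> 'a \<Rightarrow> 'a \<Rightarrow> 'a^2^2" where
  "mat2 p q r t = (\<chi> i j. if i = 0 then if j = 0 then p else q else if j = 0 then r else t)"

lemma mat2_nth [simp]:
  "mat2 p q r t $ 0 $ 0 = p" "mat2 p q r t $ 0 $ 1 = q"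
  "mat2 p q r t $ 1 $ 0 = r" "mat2 p q r t $ 1 $ 1 = t"
  by (simp_all add: mat2_def)

lemma det_mat2: "det (mat2 p q r t) = p * t - q * (r :: 'a::comm_ring_1)"
  by (simp add: det_2')

text \<open>Row reduction: a nonzero coordinate is scaled to 1 and, if necessary, moved to the top;
  the other coordinate is cleared.\<close>

lemma ex_invertible_to_axis:
  fixes u :: "'a::field^2"
  assumes "u \<noteq> 0"
  obtains A :: "'a^2^2" where "invertible A" "A *v u = axis 0 1"
proof (cases "u $ 0 = 0")
  case True
  then have "u $ 1 \<noteq> 0"
    using assms by (auto simp: vec_eq_iff all_2)
  then show ?thesis
    using that[of "mat2 0 (1 / u $ 1) 1 0"] True
    by (simp add: invertible_det_nz det_mat2 vec_eq_iff all_2 matrix_vector_mult_def sum_2' axis_def)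
next
  case False
  then show ?thesis
    using that[of "mat2 (1 / u $ 0) 0 (- u $ 1 / u $ 0) 1"]
    by (simp add: invertible_det_nz det_mat2 vec_eq_iff all_2 matrix_vector_mult_def sum_2' axis_def)
qed

definition vec4 :: "'a^2 \<Rightarrow> 'a^2 \<Rightarrow> 'a^4" where
  "vec4 u w = (\<chi> i. (if i \<in> {0, 1} then u else w) $ half i)"

lemma vec4_nth [simp]:
  "vec4 u w $ 0 = u $ 0" "vec4 u w $ 1 = u $ 1" "vec4 u w $ 2 = w $ 0" "vec4 u w $ 3 = w $ 1"
  by (simp_all add: vec4_def)

lemma vec4_cases:
  obtains u w where "v = vec4 u w"
proof
  show "v = vec4 (\<chi> i. v $ (if i = 0 then 0 else 1)) (\<chi> i. v $ (if i = 0 then 2 else 3))"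
    by (simp add: vec_eq_iff all_4)
qed

lemma block4_mult_vec4:
  "block4 A B C D *v vec4 u w = vec4 (A *v u + B *v w) (C *v u + D *v w)"
  by (simp add: vec_eq_iff all_4 matrix_vector_mult_def sum_4' sum_2' add.assoc)

lemma vec4_add: "vec4 u w + vec4 u' w' = vec4 (u + u') (w + w')"
  by (simp add: vec_eq_iff all_4)

lemma b_eq_vec4: "b 0 = vec4 (axis 0 1) 0" "b 2 = vec4 0 (axis 0 1)" "0 = vec4 0 0"
  by (simp_all add: b_def vec_eq_iff all_4 axis_def)

lemma orbits_vec:
  fixes G :: "('a::field^4^4, 'm) monoid_scheme"
  assumes G: "carrier G = block_monomial"
  shows "orbits_represented_by G UNIV (*v) [0, b 0, b 0 + b 2]"
proof -
  \<comment> \<open>The number of nonzero halves, which is 0, 1, 2 on the three representatives in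
    order.\<close>
  define f :: "'a^4 \<Rightarrow> nat"
    where "f v = of_bool (v $ 0 \<noteq> 0 \<or> v $ 1 \<noteq> 0) + of_bool (v $ 2 \<noteq> 0 \<or> v $ 3 \<noteq> 0)" for v
  have f: "f (vec4 u w) = of_bool (u \<noteq> 0) + of_bool (w \<noteq> 0)" for u w
    by (simp add: f_def vec_eq_iff all_2)
  have ax: "axis 0 1 \<noteq> (0 :: 'a^2)"
    by (simp add: vec_eq_iff all_2 axis_def)
  show ?thesis
  proof (rule orbits_represented_byI[where f = f])
    show "f (M *v v) = f v" if "M \<in> carrier G" for M v
    proof -
      obtain u w where v: "v = vec4 u w"
        by (rule vec4_cases)
      show ?thesis
        using that by (auto simp: G block_monomial_def v block4_mult_vec4 f invertible_mult_vec_eq_0_iff)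
    qed
    show "f ([0, b 0, b 0 + b 2] ! i) = i" if "i < length [0, b 0, b 0 + b 2 :: 'a^4]" for i
      using that ax by (auto simp: b_eq_vec4 vec4_add f less_Suc_eq simp del: of_bool_eq_0_iff)
    show "\<exists>M\<in>carrier G. M *v v \<in> set [0, b 0, b 0 + b 2]" for v
    proof -
      obtain u w where v: "v = vec4 u w"
        by (rule vec4_cases)
      \<comment> \<open>For \<open>x = 0\<close> this is just some invertible matrix, so
        \<open>N u\<close> and \<open>N w\<close> can always serve as blocks.\<close>
      define N where "N x = (SOME A :: 'a^2^2. invertible A \<and> (x \<noteq> 0 \<longrightarrow> A *v x = axis 0 1))" for x
      have N: "invertible (N x) \<and> (x \<noteq> 0 \<longrightarrow> N x *v x = axis 0 1)" for x
      proof -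
        have "\<exists>A :: 'a^2^2. invertible A \<and> (x \<noteq> 0 \<longrightarrow> A *v x = axis 0 1)"
        proof (cases "x = 0")
          case True
          then show ?thesis
            using invertible_def matrix_mul_lid by blast
        next
          case False
          then show ?thesis
            by (metis ex_invertible_to_axis)
        qed
        then show ?thesis
          unfolding N_def by (rule someI_ex)
      qed
      show ?thesis
      proof (cases "u = 0")
        case True
        \<comment> \<open>An antidiagonal matrix moves the possibly nonzero lower half to the top,
          where \<open>b 0\<close> has its entry.\<close>
        have "block4 0 (N w) (N u) 0 *v v \<in> set [0, b 0, b 0 + b 2]"
          using True N[of w] by (cases "w = 0") (simp_all add: b_eq_vec4 vec4_add v block4_mult_vec4)
        then show ?thesis
          using N unfolding G block_monomial_def by blast
      next
        case False
        have "block4 (N u) 0 0 (N w) *v v \<in> set [0, b 0, b 0 + b 2]"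
          using False N[of u] N[of w] by (cases "w = 0") (simp_all add: b_eq_vec4 vec4_add v block4_mult_vec4)
        then show ?thesis
          using N unfolding G block_monomial_def by blast
      qed
    qed
  qed simp
qed

section \<open>Orbits on the quotient by \<open>S\<close>\<close>

lemma act_block_monomial_Lam: "M \<in> block_monomial \<Longrightarrow> X \<in> Lam \<Longrightarrow> act M X \<in> Lam"
  by (auto simp: block_monomial_def Lam_eq act_block_diag act_block_antidiag skew4_eq_iff)

text \<open>Cosets of \<open>S\<close> are thereby compared through the block \<open>C\<close>
  alone.\<close>

lemma skew4_coset_span:
  "skew4 x C y +o {skew4 x 0 y | x y. True} = {skew4 x' C y' | x' y'. True}"
proof (intro subset_antisym subsetI)
  fix X
  assume "X \<in> {skew4 x' C y' | x' y'. True}"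
  then obtain x' y' where "X = skew4 x C y + skew4 (x' - x) 0 (y' - y)"
    by (auto simp: skew4_add)
  then show "X \<in> skew4 x C y +o {skew4 x 0 y | x y. True}"
    by (auto simp: elt_set_plus_def)
qed (auto simp: elt_set_plus_def skew4_add skew4_eq_iff)

lemma skew4_coset_perp:
  "skew4 x C y +o {skew4 0 C 0 | C. True} = {skew4 x C' y | C'. True}"
proof (intro subset_antisym subsetI)
  fix X
  assume "X \<in> {skew4 x C' y | C'. True}"
  then obtain C' where "X = skew4 x C y + skew4 0 (C' - C) 0"
    by (auto simp: skew4_add)
  then show "X \<in> skew4 x C y +o {skew4 0 C 0 | C. True}"
    by (auto simp: elt_set_plus_def)
qed (auto simp: elt_set_plus_def skew4_add skew4_eq_iff)

text \<open>A matrix of rank one is a column times a row: its column and its row through a nonzero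
  pivot, the row divided by the pivot.\<close>

lemma singular_2_factor:
  fixes C :: "'a::field^2^2"
  assumes "C \<noteq> 0" "det C = 0"
  obtains u v where "u \<noteq> 0" "v \<noteq> 0" "\<And>i j. C $ i $ j = u $ i * v $ j"
proof -
  \<comment> \<open>With a repeated row or column index the identity is trivial; the other cases all
    say that the determinant vanishes.\<close>
  have minors: "\<forall>i j k l. C $ i $ j * C $ k $ l = C $ i $ l * C $ k $ j"
    using assms(2) unfolding all_2 by (simp add: det_2' algebra_simps)
  obtain k l where kl: "C $ k $ l \<noteq> 0"
    using assms(1) by (auto simp: vec_eq_iff)
  show ?thesis
  proof (rule that)
    show "(\<chi> i. C $ i $ l) \<noteq> 0" "(\<chi> j. C $ k $ j / C $ k $ l) \<noteq> 0"
      using kl by (auto simp: vec_eq_iff)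
    show "C $ i $ j = (\<chi> i. C $ i $ l) $ i * (\<chi> j. C $ k $ j / C $ k $ l) $ j" for i j
      using kl minors by (simp add: field_simps)
  qed
qed

lemma singular_2_normal_form:
  fixes C :: "'a::field^2^2"
  assumes "C \<noteq> 0" "det C = 0"
  obtains A B :: "'a^2^2" where "invertible A" "invertible B" "A ** C ** transpose B = axis 0 (axis 0 1)"
proof -
  obtain u v where uv: "u \<noteq> 0" "v \<noteq> 0" and C: "\<And>i j. C $ i $ j = u $ i * v $ j"
    using assms by (rule singular_2_factor) blast
  obtain A :: "'a^2^2" where A: "invertible A" "A *v u = axis 0 1"
    using uv(1) by (rule ex_invertible_to_axis)
  obtain B :: "'a^2^2" where B: "invertible B" "B *v v = axis 0 1"
    using uv(2) by (rule ex_invertible_to_axis)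
  \<comment> \<open>With \<open>C\<close> the product of the column \<open>u\<close> and the row
    \<open>v\<close>, the two factors are transformed separately.\<close>
  have "(A ** C ** transpose B) $ i $ j = (A *v u) $ i * (B *v v) $ j" for i j
    by (simp add: matrix_matrix_mult_def matrix_vector_mult_def transpose_def sum_2' C algebra_simps)
  then have "A ** C ** transpose B = axis 0 (axis 0 1)"
    by (simp add: A B vec_eq_iff axis_def)
  then show ?thesis
    using A(1) B(1) that by blast
qed

lemma orbits_Lam_quot_span:
  fixes G :: "('a::field^4^4, 'm) monoid_scheme" and U :: "('a^4^4) set"
  assumes G: "carrier G = block_monomial"
  defines "U \<equiv> {skew4 x 0 y | x y. True}"
  shows "orbits_represented_by G (Lam_quot U) act_set
    (map (\<lambda>R. R +o U) [0, s 0 2, s 0 2 + s 1 3])"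
proof -
  \<comment> \<open>The rank of a 2x2 matrix, expressed by two vanishing conditions that
    multiplication by invertible matrices preserves.\<close>
  define rk :: "'a^2^2 \<Rightarrow> nat" where "rk C = (if C = 0 then 0 else if det C = 0 then 1 else 2)" for C
  have rk_mult: "rk (A ** C ** transpose B) = rk C" if "invertible A" "invertible B" for A B C
    using that by (simp add: rk_def invertible_mult_eq_0_left_iff invertible_mult_eq_0_right_iff
        invertible_transpose_iff det_mul) (simp add: invertible_det_nz)
  have rk_minus: "rk (- C) = rk C" and rk_transpose: "rk (transpose C) = rk C" for C
    by (auto simp: rk_def det_2' vec_eq_iff all_2 transpose_def)
  \<comment> \<open>The rank of the upper right block, read off from the entries because
    \<open>f\<close> is a function on all matrices.\<close>
  define f :: "'a^4^4 \<Rightarrow> nat"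
    where "f X = rk (\<chi> i j. X $ (if i = 0 then 0 else 1) $ (if j = 0 then 2 else 3))" for X
  have f: "f (skew4 x C y) = rk C" for x C y
    unfolding f_def by (rule arg_cong[of _ _ rk]) (simp add: skew4_def vec_eq_iff all_2)
  have coset: "skew4 x C y +o U = {skew4 x' C y' | x' y'. True}" for x C y
    unfolding U_def by (rule skew4_coset_span)
  show ?thesis
  proof (rule orbits_represented_by_cosetsI[where f = f])
    show "act_set M U = U" if "M \<in> carrier G" for M
    proof -
      have "M \<in> stabilizer GL4 act_set U"
        using that by (simp only: G U_def stabilizer_span)
      then show ?thesis
        by (simp add: stabilizer_def)
    qed
    show "0 \<in> U"
      using skew4_0 by (force simp: U_def)
    show "f (X + Y) = f X" if "X \<in> Lam" "Y \<in> U" for X Y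
      using that by (auto simp: Lam_eq U_def skew4_add f)
    show "f (act M X) = f X" if "M \<in> carrier G" "X \<in> Lam" for M X
      using that by (auto simp: G block_monomial_def Lam_eq act_block_diag act_block_antidiag f
          rk_mult rk_minus rk_transpose)
    show "set [0, s 0 2, s 0 2 + s 1 3] \<subseteq> Lam"
      by (auto simp: Lam_eq s_eq_skew4 skew4_add axis_add_axis_eq_mat_1 simp flip: skew4_0)
    have "rk 0 = 0" "rk (axis 0 (axis 0 1)) = 1" "rk (mat 1) = 2"
      by (auto simp: rk_def det_2' vec_eq_iff all_2 axis_def mat_def)
    then show "f ([0, s 0 2, s 0 2 + s 1 3] ! i) = i"
      if "i < length [0, s 0 2, s 0 2 + s 1 3 :: 'a^4^4]" for i
      using that by (auto simp: s_eq_skew4 skew4_add axis_add_axis_eq_mat_1 f less_Suc_eq simp flip: skew4_0)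
    show "\<exists>M\<in>carrier G. \<exists>R\<in>set [0, s 0 2, s 0 2 + s 1 3]. act M X +o U = R +o U"
      if X_Lam: "X \<in> Lam" for X
    proof -
      obtain x C y where X: "X = skew4 x C y"
        using X_Lam by (auto simp: Lam_eq)
      have one: "invertible (mat 1 :: 'a^2^2)"
        by (simp add: invertible_det_nz)
      have "\<exists>A B :: 'a^2^2. invertible A \<and> invertible B \<and>
          A ** C ** transpose B \<in> {0, axis 0 (axis 0 1), mat 1}"
      proof (cases "C = 0 \<or> det C \<noteq> 0")
        case False
        then have "C \<noteq> 0" "det C = 0"
          by simp_all
        then obtain A B :: "'a^2^2" where "invertible A" "invertible B"
            "A ** C ** transpose B = axis 0 (axis 0 1)"
          by (rule singular_2_normal_form)
        then show ?thesis
          by blast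
      next
        case True
        \<comment> \<open>Outside rank one, multiplication on one side is enough: \<open>A\<close>
          can be the identity if \<open>C = 0\<close>, and the inverse of \<open>C\<close> if
          \<open>C\<close> is invertible.\<close>
        then obtain A :: "'a^2^2" where "invertible A" "A ** C = 0 \<or> A ** C = mat 1"
          using one by (metis invertible_det_nz invertible_left_inverse invertible_right_inverse times0_right)
        then have "A ** C ** transpose (mat 1) \<in> {0, axis 0 (axis 0 1), mat 1}"
          by auto
        then show ?thesis
          using one \<open>invertible A\<close> by blast
      qed
      then obtain A B :: "'a^2^2" where AB: "invertible A" "invertible B"
          "A ** C ** transpose B \<in> {0, axis 0 (axis 0 1), mat 1}"
        by blast
      from AB(3) have "\<exists>R\<in>set [0, s 0 2, s 0 2 + s 1 3]. act (block4 A 0 0 B) X +o U = R +o U"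
        by (elim insertE emptyE)
          (simp_all add: X act_block_diag coset s_eq_skew4 skew4_add axis_add_axis_eq_mat_1
            flip: skew4_0)
      then show ?thesis
        using AB(1,2) unfolding G block_monomial_def by blast
    qed
  qed (simp add: G act_block_monomial_Lam)
qed

section \<open>Orbits on the quotient by the orthogonal space\<close>

lemma orbits_Lam_quot_perp:
  fixes G :: "('a::field^4^4, 'm) monoid_scheme" and U :: "('a^4^4) set"
  assumes G: "carrier G = block_monomial"
  defines "U \<equiv> {skew4 0 C 0 | C. True}"
  shows "orbits_represented_by G (Lam_quot U) act_set
    (map (\<lambda>R. R +o U) [0, s 0 1, s 0 1 + s 2 3])"
proof -
  \<comment> \<open>The number of nonzero coefficients among those of \<open>s 0 1\<close> and
    \<open>s 2 3\<close>.\<close>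
  define f :: "'a^4^4 \<Rightarrow> nat" where "f X = of_bool (X $ 0 $ 1 \<noteq> 0) + of_bool (X $ 2 $ 3 \<noteq> 0)" for X
  have f: "f (skew4 x C y) = of_bool (x \<noteq> 0) + of_bool (y \<noteq> 0)" for x C y
    by (simp add: f_def skew4_def)
  have coset: "skew4 x C y +o U = {skew4 x C' y | C'. True}" for x C y
    unfolding U_def by (rule skew4_coset_perp)
  show ?thesis
  proof (rule orbits_represented_by_cosetsI[where f = f])
    show "act_set M U = U" if "M \<in> carrier G" for M
    proof -
      have "M \<in> stabilizer GL4 act_set U"
        using that by (simp only: G U_def stabilizer_perp)
      then show ?thesis
        by (simp add: stabilizer_def)
    qed
    show "0 \<in> U"
      using skew4_0 by (force simp: U_def)
    show "f (X + Y) = f X" if "X \<in> Lam" "Y \<in> U" for X Y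
      using that by (auto simp: Lam_eq U_def skew4_add f)
    show "f (act M X) = f X" if "M \<in> carrier G" "X \<in> Lam" for M X
      using that by (auto simp: G block_monomial_def Lam_eq act_block_diag act_block_antidiag f
          invertible_det_nz)
    show "set [0, s 0 1, s 0 1 + s 2 3] \<subseteq> Lam"
      by (auto simp: Lam_eq s_eq_skew4 skew4_add skew4_eq_iff simp flip: skew4_0)
    show "f ([0, s 0 1, s 0 1 + s 2 3] ! i) = i"
      if "i < length [0, s 0 1, s 0 1 + s 2 3 :: 'a^4^4]" for i
      using that by (auto simp: s_eq_skew4 skew4_add f less_Suc_eq simp flip: skew4_0)
    show "\<exists>M\<in>carrier G. \<exists>R\<in>set [0, s 0 1, s 0 1 + s 2 3]. act M X +o U = R +o U"
      if X_Lam: "X \<in> Lam" for X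
    proof -
      obtain x C y where X: "X = skew4 x C y"
        using X_Lam by (auto simp: Lam_eq)
      \<comment> \<open>The blocks act on the two coefficients through their determinants, so
        \<open>D c\<close> is chosen with determinant \<open>1 / c\<close> to normalize a nonzero
        \<open>c\<close> to 1.\<close>
      define D :: "'a \<Rightarrow> 'a^2^2" where "D c = mat2 (if c = 0 then 1 else 1 / c) 0 0 1" for c
      have D: "invertible (D c)" "det (D c) * c = of_bool (c \<noteq> 0)" for c
        by (auto simp: D_def invertible_det_nz det_mat2)
      show ?thesis
      proof (cases "x = 0")
        case True
        \<comment> \<open>The antidiagonal matrix carries the coefficient \<open>y\<close> of
          \<open>s 2 3\<close> to \<open>s 0 1\<close>, so \<open>D y\<close> has to be the upper
          block.\<close>
        then have "\<exists>R\<in>set [0, s 0 1, s 0 1 + s 2 3]. act (block4 0 (D y) (D x) 0) X +o U = R +o U"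
          by (cases "y = 0") (simp_all add: X act_block_antidiag D coset skew4_add s_eq_skew4
              flip: skew4_0)
        then show ?thesis
          using D(1) unfolding G block_monomial_def by blast
      next
        case False
        then have "\<exists>R\<in>set [0, s 0 1, s 0 1 + s 2 3]. act (block4 (D x) 0 0 (D y)) X +o U = R +o U"
          by (cases "y = 0") (simp_all add: X act_block_diag D coset skew4_add s_eq_skew4
              flip: skew4_0)
        then show ?thesis
          using D(1) unfolding G block_monomial_def by blast
      qed
    qed
  qed (simp add: G act_block_monomial_Lam)
qed

theorem proposition4p5:
  fixes S :: "('a::field^4^4) set"
  assumes S: "S = mat.span {s 0 1, s 2 3}"
  shows "stabilizer GL4 act_set S =
           {block4 A 0 0 B | A B. invertible A \<and> invertible B} \<union>
           {block4 0 A B 0 | A B. invertible A \<and> invertible B}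
    \<and> stabilizer GL4 act_set S = stabilizer GL4 act_set (perp S)
    \<and> orbits_represented_by (GL4_stab S) UNIV (*v) [0, b 0, b 0 + b 2]
    \<and> orbits_represented_by (GL4_stab S) (Lam_quot S) act_set
           [S, s 0 2 +o S, (s 0 2 + s 1 3) +o S]
    \<and> orbits_represented_by (GL4_stab S) (Lam_quot (perp S)) act_set
           [perp S, s 0 1 +o perp S, (s 0 1 + s 2 3) +o perp S]"
proof -
  have S': "S = {skew4 x 0 y | x y. True}"
    unfolding S by (rule span_s01_s23)
  have perp: "perp S = {skew4 0 C 0 | C. True}"
    unfolding S by (rule perp_s01_s23)
  have stab: "stabilizer GL4 act_set S = block_monomial"
    unfolding S' by (rule stabilizer_span)
  have stab_perp: "stabilizer GL4 act_set (perp S) = block_monomial"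
    unfolding perp by (rule stabilizer_perp)
  have G: "carrier (GL4_stab S) = block_monomial"
    by (simp add: stab)
  show ?thesis
    \<comment> \<open>The lists in the orbit lemmas begin with \<open>0 +o S\<close> and
      \<open>0 +o perp S\<close>, which simplify to \<open>S\<close> and
      \<open>perp S\<close>.\<close>
    unfolding stab_perp
    using stab orbits_vec[OF G] orbits_Lam_quot_span[OF G, folded S']
      orbits_Lam_quot_perp[OF G, folded perp]
    by (simp flip: block_monomial_def)
qed

end
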